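(* Let $(X,\mathcal{A})$ be a separated measurable space with $\mathcal{A}$ infinite. Then: (a) $\mathcal{M}_F(X,\mathcal{A})$ is equal to the intersection of all free ideals of $\mathcal{M}(X,\mathcal{A})$, and it is also equal to the intersection of all free ideals of $\mathcal{M}^*(X,\mathcal{A})$. (b) $\mathcal{M}_F(X,\mathcal{A})$ is a free ideal of $\mathcal{M}(X,\mathcal{A})$ (respectively, of $\mathcal{M}^*(X,\mathcal{A})$) if and only if $\mathcal{A}$ is locally finite, in the sense that for every $x\in X$ there is $A\in\mathcal{A}$ such that $x\in A$ and $A$ is a finite set.
   Context: A measurable space $(X,\mathcal{A})$ is a nonempty set $X$ with a $\sigma$-algebra $\mathcal{A}$ of subsets of $X$. $\mathcal{M}(X,\mathcal{A})$ is the ring (pointwise operations) of all $\mathcal{A}$-measurable functions $f:X\to\mathbb{R}$, and $\mathcal{M}^*(X,\mathcal{A})$ is its subring of bounded functions. $Z(f)=\{x\in X:f(x)=0\}$. $(X,\mathcal{A})$ is separated if for any two distinct points $p,q\in X$ there is $E\in\mathcal{A}$ containing exactly one of them. $\mathcal{M}_F(X,\mathcal{A})=\{f\in\mathcal{M}(X,\mathcal{A}): X\setminus Z(f)\text{ is finite (possibly empty)}\}$. Ideals are assumed proper. An ideal $I$ of $\mathcal{M}(X,\mathcal{A})$ (respectively $\mathcal{M}^*(X,\mathcal{A})$) is free if $\bigcap_{f\in I}Z(f)=\emptyset$. *)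

theory Defs
  imports "HOL-Analysis.Analysis" "HOL-Algebra.Ideal"
begin

definition separated_space :: "'a set \<Rightarrow> 'a set set \<Rightarrow> bool" where
  "separated_space X A \<longleftrightarrow>
     (\<forall>p\<in>X. \<forall>q\<in>X. p \<noteq> q \<longrightarrow> (\<exists>E\<in>A. (p \<in> E \<and> q \<notin> E) \<or> (q \<in> E \<and> p \<notin> E)))"

text \<open>
  A function from \<open>X\<close> to the reals is represented by its extensional representative (value
  \<open>undefined\<close> off \<open>X\<close>), so that equality in the ring is equality of functions on \<open>X\<close>.
  When \<open>A\<close> is a sigma-algebra on \<open>X\<close>, the measurable sets of \<open>sigma X A\<close> are exactly those in \<open>A\<close>.
\<close>

definition fun_ring :: "'a set \<Rightarrow> ('a \<Rightarrow> real) set \<Rightarrow> ('a \<Rightarrow> real) ring" where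
  "fun_ring X C =
     \<lparr>carrier = C,
      monoid.mult = (\<lambda>f g. \<lambda>x\<in>X. f x * g x),
      one = (\<lambda>x\<in>X. 1),
      zero = (\<lambda>x\<in>X. 0),
      add = (\<lambda>f g. \<lambda>x\<in>X. f x + g x)\<rparr>"

definition meas_ring :: "'a set \<Rightarrow> 'a set set \<Rightarrow> ('a \<Rightarrow> real) ring" where
  "meas_ring X A = fun_ring X (borel_measurable (sigma X A) \<inter> extensional X)"

definition bdd_meas_ring :: "'a set \<Rightarrow> 'a set set \<Rightarrow> ('a \<Rightarrow> real) ring" where
  "bdd_meas_ring X A = fun_ring X {f \<in> carrier (meas_ring X A). bounded (f ` X)}"

definition zero_set :: "'a set \<Rightarrow> ('a \<Rightarrow> real) \<Rightarrow> 'a set" where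
  "zero_set X f = {x \<in> X. f x = 0}"

definition meas_fin :: "'a set \<Rightarrow> 'a set set \<Rightarrow> ('a \<Rightarrow> real) set" where
  "meas_fin X A = {f \<in> carrier (meas_ring X A). finite (X - zero_set X f)}"

text \<open>The library's \<^const>\<open>ideal\<close> admits the whole ring; here ideals are required to be proper.\<close>

definition free_ideal :: "'a set \<Rightarrow> ('a \<Rightarrow> real) ring \<Rightarrow> ('a \<Rightarrow> real) set \<Rightarrow> bool" where
  "free_ideal X R I \<longleftrightarrow> ideal I R \<and> I \<noteq> carrier R \<and> (\<Inter>f\<in>I. zero_set X f) = {}"

definition locally_finite_algebra :: "'a set \<Rightarrow> 'a set set \<Rightarrow> bool" where
  "locally_finite_algebra X A \<longleftrightarrow> (\<forall>x\<in>X. \<exists>E\<in>A. x \<in> E \<and> finite E)"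

lemma cring_fun_ring:
  assumes ext: "C \<subseteq> extensional X"
    and const: "(\<lambda>x\<in>X. 0) \<in> C" "(\<lambda>x\<in>X. 1) \<in> C"
    and add: "\<And>f g. f \<in> C \<Longrightarrow> g \<in> C \<Longrightarrow> (\<lambda>x\<in>X. f x + g x) \<in> C"
    and mult: "\<And>f g. f \<in> C \<Longrightarrow> g \<in> C \<Longrightarrow> (\<lambda>x\<in>X. f x * g x) \<in> C"
    and neg: "\<And>f. f \<in> C \<Longrightarrow> (\<lambda>x\<in>X. - f x) \<in> C"
  shows "cring (fun_ring X C)"
proof (rule cringI)
  have e: "f x = undefined" if "f \<in> C" "x \<notin> X" for f x
    using ext that by (auto simp: extensional_def)
  show "abelian_group (fun_ring X C)"
  proof (rule abelian_groupI)
    fix f assume "f \<in> carrier (fun_ring X C)"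
    then show "\<exists>g\<in>carrier (fun_ring X C). g \<oplus>\<^bsub>fun_ring X C\<^esub> f = \<zero>\<^bsub>fun_ring X C\<^esub>"
      by (intro bexI[of _ "\<lambda>x\<in>X. - f x"]) (auto simp: fun_ring_def neg)
  qed (use const add in \<open>auto simp: fun_ring_def e fun_eq_iff restrict_def\<close>)
  show "comm_monoid (fun_ring X C)"
    by (rule comm_monoidI) (use const mult in \<open>auto simp: fun_ring_def e fun_eq_iff restrict_def\<close>)
qed (auto simp: fun_ring_def fun_eq_iff restrict_def algebra_simps)

lemma carrier_meas_ring:
  "carrier (meas_ring X A) = borel_measurable (sigma X A) \<inter> extensional X"
  by (simp add: meas_ring_def fun_ring_def)

lemma restrict_in_meas_ring:
  assumes "sigma_algebra X A" "f \<in> borel_measurable (sigma X A)"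
  shows "(\<lambda>x\<in>X. f x) \<in> carrier (meas_ring X A)"
proof -
  interpret sigma_algebra X A by fact
  have "space (sigma X A) = X" by (simp add: space_closed)
  then have "(\<lambda>x\<in>X. f x) \<in> borel_measurable (sigma X A)"
    using assms(2) by (subst measurable_cong[of _ _ f]) auto
  then show ?thesis by (simp add: carrier_meas_ring)
qed

lemma cring_meas_ring:
  assumes "sigma_algebra X A"
  shows "cring (meas_ring X A)"
proof -
  have "cring (fun_ring X (carrier (meas_ring X A)))"
    by (rule cring_fun_ring; (rule restrict_in_meas_ring[OF assms])?)
      (auto simp: carrier_meas_ring)
  then show ?thesis by (simp add: meas_ring_def fun_ring_def)
qed

lemma cring_bdd_meas_ring:
  assumes "sigma_algebra X A"
  shows "cring (bdd_meas_ring X A)"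
  unfolding bdd_meas_ring_def
proof (rule cring_fun_ring)
  note r = restrict_in_meas_ring[OF assms]
  let ?C = "{f \<in> carrier (meas_ring X A). bounded (f ` X)}"
  show "?C \<subseteq> extensional X" by (auto simp: carrier_meas_ring)
  show "(\<lambda>x\<in>X. 0) \<in> ?C" "(\<lambda>x\<in>X. 1) \<in> ?C"
    using r[of "\<lambda>_. 0"] r[of "\<lambda>_. 1"] by (auto simp: bounded_iff)
  fix f assume f: "f \<in> ?C"
  then obtain b where b: "\<And>x. x \<in> X \<Longrightarrow> \<bar>f x\<bar> \<le> b" by (auto simp: bounded_iff)
  show "(\<lambda>x\<in>X. - f x) \<in> ?C"
    using f b r[of "\<lambda>x. - f x"] by (auto simp: carrier_meas_ring bounded_iff)
  fix g assume g: "g \<in> ?C"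
  then obtain c where c: "\<And>x. x \<in> X \<Longrightarrow> \<bar>g x\<bar> \<le> c" by (auto simp: bounded_iff)
  have "\<bar>f x + g x\<bar> \<le> b + c" "\<bar>f x * g x\<bar> \<le> b * c" if "x \<in> X" for x
    using b[OF that] c[OF that] by (auto simp: abs_mult intro!: mult_mono)
  then have "bounded ((\<lambda>x\<in>X. f x + g x) ` X)" "bounded ((\<lambda>x\<in>X. f x * g x) ` X)"
    by (auto simp: bounded_iff)
  moreover have "(\<lambda>x\<in>X. f x + g x) \<in> carrier (meas_ring X A)"
      "(\<lambda>x\<in>X. f x * g x) \<in> carrier (meas_ring X A)"
    using f g by (auto simp: carrier_meas_ring intro!: r[unfolded carrier_meas_ring, THEN IntD1])
  ultimately show "(\<lambda>x\<in>X. f x + g x) \<in> ?C" "(\<lambda>x\<in>X. f x * g x) \<in> ?C" by auto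
qed

end

theory Submission imports Defs begin

text \<open>
  A function with finite support lies in every free ideal \<open>I\<close>: a sum \<open>h\<close> of finitely many squares
  from \<open>I\<close> is positive on the support of \<open>f\<close>, and \<open>f = (f / h) h\<close> where \<open>f / h\<close>, read as 0
  where \<open>h\<close> vanishes, has finite range.

  Conversely, let \<open>f\<close> have infinite support. Separating two points again and again, one obtains a
  decreasing sequence of nonempty measurable subsets \<open>F n\<close> of the support with empty intersection.
  The functions vanishing on some \<open>F n\<close> form a free ideal that omits \<open>f\<close>.
\<close>

section \<open>Ideals and free ideals in rings of functions\<close>

lemma ideal_fun_ringI:
  assumes "cring (fun_ring X C)" and "I \<subseteq> C" and "(\<lambda>x\<in>X. 0) \<in> I"
    and add: "\<And>f g. f \<in> I \<Longrightarrow> g \<in> I \<Longrightarrow> (\<lambda>x\<in>X. f x + g x) \<in> I"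
    and mult: "\<And>r f. r \<in> C \<Longrightarrow> f \<in> I \<Longrightarrow> (\<lambda>x\<in>X. r x * f x) \<in> I"
  shows "ideal I (fun_ring X C)"
proof -
  let ?R = "fun_ring X C"
  interpret cring ?R by fact
  have car: "carrier ?R = C" by (simp add: fun_ring_def)
  have mult': "r \<otimes>\<^bsub>?R\<^esub> f \<in> I" if "r \<in> carrier ?R" "f \<in> I" for r f
    using mult[of r f] that by (simp add: fun_ring_def)
  \<comment> \<open>Additive inverses come from closure under multiples, because -f = (-1)
    f.\<close>
  have neg: "\<ominus>\<^bsub>?R\<^esub> f \<in> I" if "f \<in> I" for f
  proof -
    have "f \<in> carrier ?R" using that \<open>I \<subseteq> C\<close> car by auto
    then have "\<ominus>\<^bsub>?R\<^esub> f = (\<ominus>\<^bsub>?R\<^esub> \<one>\<^bsub>?R\<^esub>) \<otimes>\<^bsub>?R\<^esub> f" by (simp add: l_minus)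
    then show ?thesis using mult'[of "\<ominus>\<^bsub>?R\<^esub> \<one>\<^bsub>?R\<^esub>" f] that by simp
  qed
  show ?thesis
  proof (rule idealI)
    show "subgroup I (add_monoid ?R)"
    proof (rule group.subgroupI)
      show "group (add_monoid ?R)" by (rule add.group_axioms)
      show "I \<subseteq> carrier (add_monoid ?R)" using \<open>I \<subseteq> C\<close> by (simp add: car)
      show "I \<noteq> {}" using assms(3) by auto
      show "inv\<^bsub>add_monoid ?R\<^esub> f \<in> I" if "f \<in> I" for f
        using neg[OF that] by (simp add: a_inv_def)
      show "f \<otimes>\<^bsub>add_monoid ?R\<^esub> g \<in> I" if "f \<in> I" "g \<in> I" for f g
        using add[OF that] by (simp add: fun_ring_def)
    qed
    show "r \<otimes>\<^bsub>?R\<^esub> f \<in> I" if "f \<in> I" "r \<in> carrier ?R" for f r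
      using mult' that by blast
    show "f \<otimes>\<^bsub>?R\<^esub> r \<in> I" if "f \<in> I" "r \<in> carrier ?R" for f r
      using mult'[of r f] that m_comm[of f r] \<open>I \<subseteq> C\<close> car by auto
  qed (rule ring_axioms)
qed

lemma free_ideal_iff:
  assumes "ideal I R"
  shows "free_ideal X R I \<longleftrightarrow> I \<noteq> carrier R \<and> (\<forall>x\<in>X. \<exists>f\<in>I. f x \<noteq> 0)"
proof -
  interpret ideal I R by fact
  \<comment> \<open>An intersection over an empty family would be \<open>UNIV\<close>; the zero
    element keeps \<open>I\<close> nonempty, so the intersection of the zero sets stays inside
    \<open>X\<close>.\<close>
  have "\<zero>\<^bsub>R\<^esub> \<in> I" by simp
  then have "(\<Inter>f\<in>I. zero_set X f) = {x \<in> X. \<forall>f\<in>I. f x = 0}"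
    unfolding zero_set_def by blast
  then show ?thesis using assms by (auto simp: free_ideal_def)
qed

section \<open>Decreasing sequences of measurable sets\<close>

context sigma_algebra
begin

lemma nested_nonempty_sets:
  assumes sep: "separated_space \<Omega> M" and "E \<in> M" "infinite E"
  obtains F :: "nat \<Rightarrow> 'a set"
  where "\<And>n. F n \<in> M" "\<And>n. F n \<subseteq> E" "\<And>n. F n \<noteq> {}" "decseq F" "(\<Inter>n. F n) = {}"
proof -
  \<comment> \<open>A measurable set separating two points of \<open>G\<close> cuts it into two
    proper measurable pieces, and one of them is infinite, so the cutting never has to stop.\<close>
  have split: "\<exists>H. (H \<in> M \<and> infinite H) \<and> H \<subset> G" if G: "G \<in> M" "infinite G" for G
  proof -
    obtain p q where pq: "p \<in> G" "q \<in> G" "p \<noteq> q"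
      using infinite_arbitrarily_large[OF G(2), of 2] unfolding card_2_iff by blast
    then obtain S where S: "S \<in> M" "p \<in> S \<and> q \<notin> S \<or> q \<in> S \<and> p \<notin> S"
      using sep sets_into_space[OF G(1)] unfolding separated_space_def by blast
    have "infinite (G \<inter> S) \<or> infinite (G - S)"
      using G(2) by (metis Int_Diff_Un finite_Un)
    moreover have "G \<inter> S \<subset> G" "G - S \<subset> G" using pq S by auto
    moreover have "G \<inter> S \<in> M" "G - S \<in> M" using G S by auto
    ultimately show ?thesis by blast
  qed
  have "\<exists>G. \<forall>n. ((G n \<in> M \<and> infinite (G n)) \<and> (n = 0 \<longrightarrow> G n = E)) \<and> G (Suc n) \<subset> G n"
  proof (rule dependent_nat_choice)
    show "\<exists>H. (H \<in> M \<and> infinite H) \<and> (0 = 0 \<longrightarrow> H = E)" using assms(2,3) by simp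
    show "\<exists>K. ((K \<in> M \<and> infinite K) \<and> (Suc n = 0 \<longrightarrow> K = E)) \<and> K \<subset> H"
      if "(H \<in> M \<and> infinite H) \<and> (n = 0 \<longrightarrow> H = E)" for H n
      using split[of H] that by simp
  qed
  then obtain G :: "nat \<Rightarrow> 'a set"
    where G: "\<forall>n. ((G n \<in> M \<and> infinite (G n)) \<and> (n = 0 \<longrightarrow> G n = E)) \<and> G (Suc n) \<subset> G n"
    by (rule exE)
  then have GM: "G n \<in> M" and G0: "G 0 = E" and GS: "G (Suc n) \<subset> G n" for n
    by simp_all
  have dec: "decseq G" using GS by (intro decseq_SucI) (rule psubset_imp_subset)
  \<comment> \<open>Removing the common part makes the intersection empty. The sets stay nonempty
    because the chain is strict: a point of \<open>G n\<close> outside \<open>G (Suc n)\<close> is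
    not in the common part.\<close>
  let ?F = "\<lambda>n. G n - (\<Inter>m. G m)"
  show ?thesis
  proof
    show "?F n \<in> M" for n using GM by (intro Diff countable_INT) auto
    show "?F n \<subseteq> E" for n using decseqD[OF dec, of 0 n] G0 by auto
    show "?F n \<noteq> {}" for n using GS[of n] by auto
    show "decseq ?F" using dec by (auto simp: decseq_def)
    show "(\<Inter>n. ?F n) = {}" by auto
  qed
qed

end

section \<open>Rings between the bounded and all measurable functions\<close>

text \<open>The ring of all measurable functions and the ring of bounded ones are the two extreme
  instances, so one argument serves both.\<close>

locale intermediate_ring = sigma_algebra \<Omega> M for \<Omega> :: "'a set" and M +
  fixes C :: "('a \<Rightarrow> real) set"
  assumes bounded_sub: "carrier (bdd_meas_ring \<Omega> M) \<subseteq> C"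
    and sub_meas: "C \<subseteq> carrier (meas_ring \<Omega> M)"
    and cring: "cring (fun_ring \<Omega> C)"
begin

lemma measurable: "f \<in> C \<Longrightarrow> f \<in> borel_measurable (sigma \<Omega> M)"
  using sub_meas by (auto simp: carrier_meas_ring)

lemma space_sigma: "space (sigma \<Omega> M) = \<Omega>"
  by (simp add: space_closed)

lemma sets_sigma: "sets (sigma \<Omega> M) = M"
  by (simp add: space_closed sigma_sets_eq)

lemma carrier_fun_ring: "carrier (fun_ring \<Omega> C) = C"
  by (simp add: fun_ring_def)

lemma undefined_outside: "f \<in> C \<Longrightarrow> x \<notin> \<Omega> \<Longrightarrow> f x = undefined"
  using sub_meas by (auto simp: carrier_meas_ring extensional_def)

text \<open>Source of the functions constructed below: constants, indicators and quotients of finite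
  range are bounded, hence belong to every intermediate ring.\<close>

lemma bounded_mem:
  assumes "f \<in> borel_measurable (sigma \<Omega> M)" "bounded (f ` \<Omega>)"
  shows "(\<lambda>x\<in>\<Omega>. f x) \<in> C"
  using restrict_in_meas_ring[OF sigma_algebra_axioms assms(1)] assms(2) bounded_sub
  by (force simp: bdd_meas_ring_def fun_ring_def)

lemma indicator_mem:
  assumes "E \<in> M"
  shows "(\<lambda>x\<in>\<Omega>. indicator E x) \<in> C"
proof (rule bounded_mem)
  show "indicator E \<in> borel_measurable (sigma \<Omega> M)"
    using assms by (intro borel_measurable_indicator) (simp add: sets_sigma)
  show "bounded (indicat_real E ` \<Omega>)"
    by (auto simp: bounded_iff indicator_def intro!: exI[of _ 1])
qed

lemma zero_mem: "(\<lambda>x\<in>\<Omega>. 0) \<in> C"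
  using indicator_mem[of "{}"] by (simp add: indicator_def)

lemma one_mem: "(\<lambda>x\<in>\<Omega>. 1) \<in> C"
  by (rule bounded_mem) (auto simp: bounded_iff)

lemma add_mem: "f \<in> C \<Longrightarrow> g \<in> C \<Longrightarrow> (\<lambda>x\<in>\<Omega>. f x + g x) \<in> C"
  using ring.ring_simprules(1)[OF cring.axioms(1)[OF cring], of f g] by (simp add: fun_ring_def)

lemma mult_mem: "f \<in> C \<Longrightarrow> g \<in> C \<Longrightarrow> (\<lambda>x\<in>\<Omega>. f x * g x) \<in> C"
  using ring.ring_simprules(5)[OF cring.axioms(1)[OF cring], of f g] by (simp add: fun_ring_def)

lemma support_sets: "f \<in> C \<Longrightarrow> {x \<in> \<Omega>. f x \<noteq> 0} \<in> M"
  using measurable_sets[OF measurable, of f "- {0}"]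
  by (simp add: space_sigma sets_sigma vimage_def Int_def conj_commute)

text \<open>A function of finite support has finite range and so is bounded. Hence the set, although
  defined inside the largest ring, lies in every \<open>C\<close>.\<close>

lemma meas_fin_eq: "meas_fin \<Omega> M = {f \<in> C. finite {x \<in> \<Omega>. f x \<noteq> 0}}"
proof -
  have supp: "\<Omega> - zero_set \<Omega> f = {x \<in> \<Omega>. f x \<noteq> 0}" for f
    by (auto simp: zero_set_def)
  have "f \<in> C" if f: "f \<in> carrier (meas_ring \<Omega> M)" "finite {x \<in> \<Omega>. f x \<noteq> 0}" for f
  proof -
    have "f ` \<Omega> \<subseteq> insert 0 (f ` {x \<in> \<Omega>. f x \<noteq> 0})" by auto
    then have "bounded (f ` \<Omega>)"
      using f(2) by (meson bounded_subset finite_imageI finite_imp_bounded finite_insert)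
    then show ?thesis
      using f(1) bounded_sub by (auto simp: bdd_meas_ring_def fun_ring_def)
  qed
  then show ?thesis using sub_meas by (auto simp: meas_fin_def supp)
qed

lemma ideal_meas_fin: "ideal (meas_fin \<Omega> M) (fun_ring \<Omega> C)"
proof (rule ideal_fun_ringI[OF cring])
  show "meas_fin \<Omega> M \<subseteq> C" by (auto simp: meas_fin_eq)
  show "(\<lambda>x\<in>\<Omega>. 0) \<in> meas_fin \<Omega> M" by (simp add: meas_fin_eq zero_mem)
  show "(\<lambda>x\<in>\<Omega>. f x + g x) \<in> meas_fin \<Omega> M"
    if "f \<in> meas_fin \<Omega> M" "g \<in> meas_fin \<Omega> M" for f g
  proof -
    have "{x \<in> \<Omega>. (\<lambda>x\<in>\<Omega>. f x + g x) x \<noteq> 0} \<subseteq> {x \<in> \<Omega>. f x \<noteq> 0} \<union> {x \<in> \<Omega>. g x \<noteq> 0}"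
      by auto
    then have "finite {x \<in> \<Omega>. (\<lambda>x\<in>\<Omega>. f x + g x) x \<noteq> 0}"
      by (rule finite_subset) (use that in \<open>simp add: meas_fin_eq\<close>)
    then show ?thesis
      using that add_mem[of f g] unfolding meas_fin_eq by blast
  qed
  show "(\<lambda>x\<in>\<Omega>. r x * f x) \<in> meas_fin \<Omega> M" if "r \<in> C" "f \<in> meas_fin \<Omega> M" for r f
  proof -
    have "{x \<in> \<Omega>. (\<lambda>x\<in>\<Omega>. r x * f x) x \<noteq> 0} \<subseteq> {x \<in> \<Omega>. f x \<noteq> 0}"
      by auto
    then have "finite {x \<in> \<Omega>. (\<lambda>x\<in>\<Omega>. r x * f x) x \<noteq> 0}"
      by (rule finite_subset) (use that in \<open>simp add: meas_fin_eq\<close>)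
    then show ?thesis
      using that mult_mem[of r f] unfolding meas_fin_eq by blast
  qed
qed

section \<open>Finitely supported functions lie in every free ideal\<close>

lemma nonneg_positive_on_finite:
  assumes "free_ideal \<Omega> (fun_ring \<Omega> C) I" "finite S" "S \<subseteq> \<Omega>"
  shows "\<exists>h\<in>I. (\<forall>x\<in>\<Omega>. 0 \<le> h x) \<and> (\<forall>x\<in>S. 0 < h x)"
  using assms(2,3)
proof induction
  interpret ideal I "fun_ring \<Omega> C" using assms(1) by (simp add: free_ideal_def)
  case empty
  have "\<zero>\<^bsub>fun_ring \<Omega> C\<^esub> \<in> I" by simp
  then show ?case by (rule bexI[rotated]) (simp add: fun_ring_def)
next
  interpret ideal I "fun_ring \<Omega> C" using assms(1) by (simp add: free_ideal_def)
  case (insert s S)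
  then obtain h where h: "h \<in> I" "\<And>x. x \<in> \<Omega> \<Longrightarrow> 0 \<le> h x" "\<And>x. x \<in> S \<Longrightarrow> 0 < h x" by auto
  obtain g where g: "g \<in> I" "g s \<noteq> 0"
    using assms(1) insert.prems unfolding free_ideal_iff[OF ideal_axioms] by blast
  have "g \<in> carrier (fun_ring \<Omega> C)" using g(1) by (rule Icarr)
  then have "h \<oplus>\<^bsub>fun_ring \<Omega> C\<^esub> g \<otimes>\<^bsub>fun_ring \<Omega> C\<^esub> g \<in> I"
    using g(1) h(1)
    by (intro additive_subgroup.a_closed[OF additive_subgroup_axioms] I_l_closed)
  then have k: "(\<lambda>x\<in>\<Omega>. h x + g x * g x) \<in> I"
    by (simp add: fun_ring_def cong: restrict_cong)
  \<comment> \<open>At the new point \<open>s\<close> only \<open>0 \<le> h s\<close> is known,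
    which is why nonnegativity on all of \<open>\<Omega>\<close> is carried through the induction;
    at the old points the added square does no harm.\<close>
  have "0 < g s * g s" using g(2) by (auto simp: zero_less_mult_iff)
  then have "0 < h s + g s * g s" using h(2)[of s] insert.prems by auto
  then show ?case
    using h insert.prems by (intro bexI[OF _ k]) (auto intro!: add_pos_nonneg)
qed

lemma meas_fin_subset_free_ideal:
  assumes "free_ideal \<Omega> (fun_ring \<Omega> C) I"
  shows "meas_fin \<Omega> M \<subseteq> I"
proof
  interpret ideal I "fun_ring \<Omega> C" using assms by (simp add: free_ideal_def)
  fix f assume f: "f \<in> meas_fin \<Omega> M"
  let ?S = "{x \<in> \<Omega>. f x \<noteq> 0}"
  have fC: "f \<in> C" and fin: "finite ?S" using f by (auto simp: meas_fin_eq)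
  obtain h where h: "h \<in> I" "\<And>x. x \<in> ?S \<Longrightarrow> 0 < h x"
    using nonneg_positive_on_finite[OF assms fin] by auto
  have hC: "h \<in> C" using Icarr[OF h(1)] by (simp add: carrier_fun_ring)
  \<comment> \<open>Off \<open>?S\<close> the numerator is 0, so the quotient is 0 there whether or
    not \<open>h\<close> vanishes.\<close>
  have "(\<lambda>x. f x / h x) ` \<Omega> \<subseteq> insert 0 ((\<lambda>x. f x / h x) ` ?S)" by auto
  then have "bounded ((\<lambda>x. f x / h x) ` \<Omega>)"
    using fin by (meson bounded_subset finite_imageI finite_imp_bounded finite_insert)
  moreover have "(\<lambda>x. f x / h x) \<in> borel_measurable (sigma \<Omega> M)"
    using measurable[OF fC] measurable[OF hC] by simp
  ultimately have "(\<lambda>x\<in>\<Omega>. f x / h x) \<in> C" by (intro bounded_mem)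
  then have "(\<lambda>x\<in>\<Omega>. f x / h x) \<otimes>\<^bsub>fun_ring \<Omega> C\<^esub> h \<in> I"
    using h(1) by (intro I_l_closed) (auto simp: carrier_fun_ring)
  \<comment> \<open>On \<open>?S\<close> the factor \<open>h\<close> cancels, on the rest of
    \<open>\<Omega>\<close> both sides are 0, and off \<open>\<Omega>\<close> both are
    \<open>undefined\<close>.\<close>
  also have "(\<lambda>x\<in>\<Omega>. f x / h x) \<otimes>\<^bsub>fun_ring \<Omega> C\<^esub> h = f"
  proof
    show "((\<lambda>x\<in>\<Omega>. f x / h x) \<otimes>\<^bsub>fun_ring \<Omega> C\<^esub> h) x = f x" for x
      using h(2)[of x] undefined_outside[OF fC, of x] by (cases "f x = 0") (auto simp: fun_ring_def)
  qed
  finally show "f \<in> I" .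
qed

section \<open>A free ideal avoiding a function of infinite support\<close>

lemma free_ideal_omitting:
  assumes "separated_space \<Omega> M" "f \<in> C" "infinite {x \<in> \<Omega>. f x \<noteq> 0}"
  shows "\<exists>I. free_ideal \<Omega> (fun_ring \<Omega> C) I \<and> f \<notin> I"
proof -
  obtain F :: "nat \<Rightarrow> 'a set" where F: "\<And>n. F n \<in> M" "\<And>n. F n \<subseteq> {x \<in> \<Omega>. f x \<noteq> 0}"
      "\<And>n. F n \<noteq> {}" "decseq F" "(\<Inter>n. F n) = {}"
    by (rule nested_nonempty_sets[OF assms(1) support_sets[OF assms(2)] assms(3)]) (rule that)
  have F\<Omega>: "x \<in> \<Omega>" if "x \<in> F n" for x n using F(2)[of n] that by auto
  define I where "I = {g \<in> C. \<exists>n. \<forall>x\<in>F n. g x = 0}"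
  \<comment> \<open>Each \<open>F n\<close> contains a point, and \<open>f\<close> is nonzero there.
    This also makes \<open>I\<close> proper.\<close>
  have "f \<notin> I" using F(2,3) by (fastforce simp: I_def)
  have ideal: "ideal I (fun_ring \<Omega> C)"
  proof (rule ideal_fun_ringI[OF cring])
    show "I \<subseteq> C" by (auto simp: I_def)
    show "(\<lambda>x\<in>\<Omega>. 0) \<in> I" using F\<Omega> by (auto simp: I_def zero_mem)
    show "(\<lambda>x\<in>\<Omega>. g x + h x) \<in> I" if gh: "g \<in> I" "h \<in> I" for g h
    proof -
      obtain m n where "\<forall>x\<in>F m. g x = 0" "\<forall>x\<in>F n. h x = 0"
        using gh by (auto simp: I_def)
      \<comment> \<open>As \<open>F\<close> decreases, \<open>F (max m n)\<close> lies in both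
        \<open>F m\<close> and \<open>F n\<close>.\<close>
      then have "\<forall>x\<in>F (max m n). (\<lambda>x\<in>\<Omega>. g x + h x) x = 0"
        using decseqD[OF F(4), of m "max m n"] decseqD[OF F(4), of n "max m n"] F\<Omega>
        by (auto simp: subset_iff)
      then show ?thesis using gh add_mem[of g h] unfolding I_def by blast
    qed
    show "(\<lambda>x\<in>\<Omega>. r x * g x) \<in> I" if "r \<in> C" "g \<in> I" for r g
      using that F\<Omega> mult_mem[of r g] by (fastforce simp: I_def)
  qed
  have "\<exists>g\<in>I. g x \<noteq> 0" if "x \<in> \<Omega>" for x
  proof -
    \<comment> \<open>Freeness comes from the empty intersection: the indicator of the complement of
      this \<open>F n\<close> vanishes on \<open>F n\<close> and is 1 at \<open>x\<close>.\<close>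
    obtain n where n: "x \<notin> F n" using F(5) by auto
    have "(\<lambda>x\<in>\<Omega>. indicator (\<Omega> - F n) x :: real) \<in> I"
      using F(1)[of n] F\<Omega> indicator_mem[of "\<Omega> - F n"] by (auto simp: I_def intro!: exI[of _ n])
    then show ?thesis using n that by (intro bexI) auto
  qed
  moreover have "I \<noteq> carrier (fun_ring \<Omega> C)"
    using \<open>f \<notin> I\<close> assms(2) by (auto simp: carrier_fun_ring)
  ultimately show ?thesis using \<open>f \<notin> I\<close> free_ideal_iff[OF ideal] by auto
qed

section \<open>Both statements for an intermediate ring\<close>

lemma meas_fin_eq_Inter_free_ideals:
  assumes "separated_space \<Omega> M" "infinite \<Omega>"
  shows "meas_fin \<Omega> M = \<Inter>{I. free_ideal \<Omega> (fun_ring \<Omega> C) I}"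
proof (intro equalityI subsetI)
  fix f assume f: "f \<in> \<Inter>{I. free_ideal \<Omega> (fun_ring \<Omega> C) I}"
  \<comment> \<open>Some free ideal must exist, since the intersection of no ideals would be
    \<open>UNIV\<close> and give no information on \<open>f\<close>. The constant 1 has infinite
    support, so a free ideal omitting it exists.\<close>
  have "{x \<in> \<Omega>. (\<lambda>x\<in>\<Omega>. 1) x \<noteq> (0::real)} = \<Omega>" by auto
  then obtain I where I: "free_ideal \<Omega> (fun_ring \<Omega> C) I"
    using free_ideal_omitting[OF assms(1) one_mem] assms(2) by auto
  then interpret ideal I "fun_ring \<Omega> C" by (simp add: free_ideal_def)
  have "f \<in> C" using f I Icarr[of f] by (auto simp: carrier_fun_ring)
  then show "f \<in> meas_fin \<Omega> M"
    using free_ideal_omitting[OF assms(1), of f] f by (auto simp: meas_fin_eq)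
qed (use meas_fin_subset_free_ideal in blast)

text \<open>Supports of finitely supported members are finite measurable sets, and indicators of
  finite measurable sets are such members. Properness holds because the constant 1 has infinite
  support.\<close>

lemma free_ideal_meas_fin_iff:
  assumes "infinite \<Omega>"
  shows "free_ideal \<Omega> (fun_ring \<Omega> C) (meas_fin \<Omega> M) \<longleftrightarrow> locally_finite_algebra \<Omega> M"
proof -
  have "{x \<in> \<Omega>. (\<lambda>x\<in>\<Omega>. 1) x \<noteq> (0::real)} = \<Omega>" by auto
  then have "(\<lambda>x\<in>\<Omega>. 1) \<notin> meas_fin \<Omega> M" using assms by (simp add: meas_fin_eq)
  then have proper: "meas_fin \<Omega> M \<noteq> carrier (fun_ring \<Omega> C)"
    using one_mem unfolding carrier_fun_ring by blast
  have "(\<exists>f\<in>meas_fin \<Omega> M. f x \<noteq> 0) \<longleftrightarrow> (\<exists>E\<in>M. x \<in> E \<and> finite E)" if x: "x \<in> \<Omega>" for x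
  proof
    assume "\<exists>f\<in>meas_fin \<Omega> M. f x \<noteq> 0"
    then obtain f where "f \<in> C" "finite {y \<in> \<Omega>. f y \<noteq> 0}" "f x \<noteq> 0"
      by (auto simp: meas_fin_eq)
    then show "\<exists>E\<in>M. x \<in> E \<and> finite E"
      using x by (intro bexI[OF _ support_sets[of f]]) simp_all
  next
    assume "\<exists>E\<in>M. x \<in> E \<and> finite E"
    then obtain E where E: "E \<in> M" "x \<in> E" "finite E" by auto
    have "{y \<in> \<Omega>. (\<lambda>x\<in>\<Omega>. indicator E x :: real) y \<noteq> 0} \<subseteq> E"
      by (auto simp: indicator_def split: if_splits)
    then have "finite {y \<in> \<Omega>. (\<lambda>x\<in>\<Omega>. indicator E x :: real) y \<noteq> 0}"
      using E(3) by (rule finite_subset)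
    then have "(\<lambda>x\<in>\<Omega>. indicator E x) \<in> meas_fin \<Omega> M"
      using indicator_mem[OF E(1)] unfolding meas_fin_eq by blast
    then show "\<exists>f\<in>meas_fin \<Omega> M. f x \<noteq> 0" by (rule bexI[rotated]) (simp add: E x)
  qed
  then show ?thesis
    unfolding free_ideal_iff[OF ideal_meas_fin] locally_finite_algebra_def using proper by blast
qed

end

theorem theorem4p3:
  fixes X :: "'a set" and A :: "'a set set"
  assumes "sigma_algebra X A" and "X \<noteq> {}"
    and "separated_space X A" and "infinite A"
  shows "(meas_fin X A = \<Inter>{I. free_ideal X (meas_ring X A) I} \<and>
          meas_fin X A = \<Inter>{I. free_ideal X (bdd_meas_ring X A) I}) \<and>
         (free_ideal X (meas_ring X A) (meas_fin X A) \<longleftrightarrow> locally_finite_algebra X A) \<and>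
         (free_ideal X (bdd_meas_ring X A) (meas_fin X A) \<longleftrightarrow> locally_finite_algebra X A)"
proof -
  interpret sigma_algebra X A by fact
  \<comment> \<open>\<open>A\<close> consists of subsets of \<open>X\<close>, and a finite set has
    only finitely many subsets.\<close>
  have "infinite X"
    using assms(4) space_closed finite_subset finite_Pow_iff by metis
  define B where "B = {f \<in> carrier (meas_ring X A). bounded (f ` X)}"
  have meas: "meas_ring X A = fun_ring X (carrier (meas_ring X A))"
    by (simp add: meas_ring_def fun_ring_def)
  have bdd: "bdd_meas_ring X A = fun_ring X B"
    by (simp add: bdd_meas_ring_def B_def)
  have carB: "carrier (bdd_meas_ring X A) = B"
    by (simp add: bdd fun_ring_def)
  interpret U: intermediate_ring X A "carrier (meas_ring X A)"
    by (intro intermediate_ring.intro intermediate_ring_axioms.intro)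
      (use assms(1) cring_meas_ring[OF assms(1)] in \<open>auto simp: carB B_def meas[symmetric]\<close>)
  interpret B: intermediate_ring X A B
    by (intro intermediate_ring.intro intermediate_ring_axioms.intro)
      (use assms(1) cring_bdd_meas_ring[OF assms(1)] in \<open>auto simp: carB bdd[symmetric]\<close>,
        simp add: B_def)
  show ?thesis
    using U.meas_fin_eq_Inter_free_ideals[OF assms(3) \<open>infinite X\<close>]
      B.meas_fin_eq_Inter_free_ideals[OF assms(3) \<open>infinite X\<close>]
      U.free_ideal_meas_fin_iff[OF \<open>infinite X\<close>] B.free_ideal_meas_fin_iff[OF \<open>infinite X\<close>]
    by (simp only: meas[symmetric] bdd[symmetric])
qed

end
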